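(* There is no first-order sentence $\sigma$ in the language of groups such that for every finite group $G$ one has $G\models\sigma$ if and only if $G$ is isomorphic to a direct power $S^k$ ($k\geq 1$) of a non-abelian simple group $S$. Likewise, there is no first-order sentence $\sigma$ in the language of groups such that for every finite group $G$ one has $G\models\sigma$ if and only if $G$ is isomorphic to a direct square $S^2=S\times S$ of a non-abelian simple group $S$.
   Context: The first-order language of group theory has a binary operation for multiplication, a unary operation for inverse, and a constant for $1$; a sentence is a formula with no free variable. *)

theory Defs
  imports "HOL-Algebra.Product_Groups" "HOL-Algebra.SimpleGroups"
begin

datatype grp_term =
    TVar nat
  | TOne
  | TInv grp_term
  | TMult grp_term grp_term

datatype grp_form =
    FEq grp_term grp_term
  | FNot grp_form
  | FAnd grp_form grp_form
  | FOr grp_form grp_form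
  | FImp grp_form grp_form
  | FAll nat grp_form
  | FEx nat grp_form

primrec term_vars :: "grp_term \<Rightarrow> nat set" where
  "term_vars (TVar i) = {i}"
| "term_vars TOne = {}"
| "term_vars (TInv t) = term_vars t"
| "term_vars (TMult s t) = term_vars s \<union> term_vars t"

primrec free_vars :: "grp_form \<Rightarrow> nat set" where
  "free_vars (FEq s t) = term_vars s \<union> term_vars t"
| "free_vars (FNot \<phi>) = free_vars \<phi>"
| "free_vars (FAnd \<phi> \<psi>) = free_vars \<phi> \<union> free_vars \<psi>"
| "free_vars (FOr \<phi> \<psi>) = free_vars \<phi> \<union> free_vars \<psi>"
| "free_vars (FImp \<phi> \<psi>) = free_vars \<phi> \<union> free_vars \<psi>"
| "free_vars (FAll i \<phi>) = free_vars \<phi> - {i}"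
| "free_vars (FEx i \<phi>) = free_vars \<phi> - {i}"

definition sentence :: "grp_form \<Rightarrow> bool" where
  "sentence \<phi> \<longleftrightarrow> free_vars \<phi> = {}"

primrec term_val :: "'a monoid \<Rightarrow> (nat \<Rightarrow> 'a) \<Rightarrow> grp_term \<Rightarrow> 'a" where
  "term_val G e (TVar i) = e i"
| "term_val G e TOne = \<one>\<^bsub>G\<^esub>"
| "term_val G e (TInv t) = inv\<^bsub>G\<^esub> (term_val G e t)"
| "term_val G e (TMult s t) = term_val G e s \<otimes>\<^bsub>G\<^esub> term_val G e t"

primrec satisfies :: "'a monoid \<Rightarrow> (nat \<Rightarrow> 'a) \<Rightarrow> grp_form \<Rightarrow> bool" where
  "satisfies G e (FEq s t) \<longleftrightarrow> term_val G e s = term_val G e t"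
| "satisfies G e (FNot \<phi>) \<longleftrightarrow> \<not> satisfies G e \<phi>"
| "satisfies G e (FAnd \<phi> \<psi>) \<longleftrightarrow> satisfies G e \<phi> \<and> satisfies G e \<psi>"
| "satisfies G e (FOr \<phi> \<psi>) \<longleftrightarrow> satisfies G e \<phi> \<or> satisfies G e \<psi>"
| "satisfies G e (FImp \<phi> \<psi>) \<longleftrightarrow> (satisfies G e \<phi> \<longrightarrow> satisfies G e \<psi>)"
| "satisfies G e (FAll i \<phi>) \<longleftrightarrow> (\<forall>a\<in>carrier G. satisfies G (e(i := a)) \<phi>)"
| "satisfies G e (FEx i \<phi>) \<longleftrightarrow> (\<exists>a\<in>carrier G. satisfies G (e(i := a)) \<phi>)"

text \<open>
  The value of \<^term>\<open>satisfies G e \<phi>\<close> depends on \<^term>\<open>e\<close> only through the free variables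
  of \<^term>\<open>\<phi>\<close>; so for a sentence the quantifier over assignments below is immaterial.
\<close>

definition models :: "'a monoid \<Rightarrow> grp_form \<Rightarrow> bool" where
  "models G \<phi> \<longleftrightarrow> (\<forall>e. range e \<subseteq> carrier G \<longrightarrow> satisfies G e \<phi>)"

definition nonabelian_simple :: "'a monoid \<Rightarrow> bool" where
  "nonabelian_simple S \<longleftrightarrow> simple_group S \<and> \<not> comm_group S"

text \<open>
  Taking the factor over the same element type as the group loses no generality: a group
  isomorphic to \<open>S\<^sup>k\<close> with \<open>k \<ge> 1\<close> contains a copy of \<open>S\<close>. The locale
  \<^locale>\<open>simple_group\<close> requires \<open>order S > 1\<close> and hence covers only finite simple groups;
  the two predicates below are meant for finite groups, where \<open>S\<close> is necessarily finite.
\<close>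

definition is_power_of_nonabelian_simple :: "'a monoid \<Rightarrow> bool" where
  "is_power_of_nonabelian_simple G \<longleftrightarrow>
    (\<exists>(S :: 'a monoid) (k :: nat). nonabelian_simple S \<and> k \<ge> 1 \<and>
       G \<cong> product_group {..<k} (\<lambda>_. S))"

definition is_square_of_nonabelian_simple :: "'a monoid \<Rightarrow> bool" where
  "is_square_of_nonabelian_simple G \<longleftrightarrow>
    (\<exists>S :: 'a monoid. nonabelian_simple S \<and> G \<cong> S \<times>\<times> S)"

text \<open>
  A formula cannot quantify over all types, so ``every finite group'' is rendered by the finite
  groups with carrier a set of natural numbers, which include every finite group up to
  isomorphism; both satisfaction of sentences and the classes above are isomorphism invariant.
\<close>

definition defines_among_finite_groups :: "grp_form \<Rightarrow> (nat monoid \<Rightarrow> bool) \<Rightarrow> bool" where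
  "defines_among_finite_groups \<sigma> P \<longleftrightarrow>
    (\<forall>G :: nat monoid. group G \<and> finite (carrier G) \<longrightarrow> (models G \<sigma> \<longleftrightarrow> P G))"

end

theory Submission
  imports Defs "HOL-Algebra.Sym_Groups" "HOL-Algebra.Weak_Morphisms"
begin

text \<open>
  The truth value of a sentence \<open>\<sigma>\<close> in a direct product \<open>G \<times> H\<close> is determined by the truth
  values in \<open>G\<close> and in \<open>H\<close> of finitely many formulas that depend on \<open>\<sigma>\<close> alone
  (\<open>satisfies_DirProd_agree\<close>, a form of the Feferman-Vaught theorem). There are only finitely many
  assignments of truth values to these formulas, but non-abelian finite simple groups of arbitrarily
  large order, so two of different orders, \<open>S\<close> and \<open>T\<close>, receive the same truth values. Hence \<open>\<sigma>\<close>
  cannot tell the square \<open>S \<times> S\<close> from \<open>S \<times> T\<close>. The latter is not a power \<open>R\<^sup>k\<close> of a simple group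
  \<open>R\<close>: every simple quotient of \<open>R\<^sup>k\<close> is isomorphic to \<open>R\<close>, whereas \<open>S\<close> and \<open>T\<close> are both quotients
  of \<open>S \<times> T\<close>. As squares are powers, this one pair of groups refutes both definability claims.

  Large simple groups are found as quotients of alternating groups. A non-trivial quotient of
  \<open>A\<^sub>n\<close>, \<open>n \<ge> 5\<close>, has order at least \<open>n - 2\<close>: in a smaller quotient two of the \<open>n - 2\<close>
  cycles \<open>(1 2 i)\<close> have the same image, so the kernel contains
  \<open>(1 2 i) (1 2 j)\<^sup>-\<^sup>1 = (1 j i)\<close>, and with one 3-cycle it contains all of \<open>A\<^sub>n\<close>
  (\<open>alt_group_quotient_large\<close>). The quotient by a maximal normal subgroup is therefore a simple group
  of order at least \<open>n - 2\<close>, and it is non-abelian since \<open>A\<^sub>n\<close> is perfect.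
\<close>

section \<open>Satisfaction in isomorphic groups\<close>

abbreviation one_val :: "'a monoid \<Rightarrow> nat \<Rightarrow> 'a" where
  "one_val G \<equiv> \<lambda>_. \<one>\<^bsub>G\<^esub>"

lemma term_val_cong:
  "(\<And>i. i \<in> term_vars t \<Longrightarrow> e i = e' i) \<Longrightarrow> term_val G e t = term_val G e' t"
  by (induction t) auto

lemma satisfies_cong:
  "(\<And>i. i \<in> free_vars \<phi> \<Longrightarrow> e i = e' i) \<Longrightarrow> satisfies G e \<phi> \<longleftrightarrow> satisfies G e' \<phi>"
proof (induction \<phi> arbitrary: e e')
  case (FEq s t)
  then show ?case using term_val_cong[of s e e' G] term_val_cong[of t e e' G] by auto
next
  case (FNot \<phi>)
  then show ?case by (metis free_vars.simps(2) satisfies.simps(2))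
next
  case (FAnd \<phi> \<psi>)
  then show ?case by (metis UnCI free_vars.simps(3) satisfies.simps(3))
next
  case (FOr \<phi> \<psi>)
  then show ?case by (metis UnCI free_vars.simps(4) satisfies.simps(4))
next
  case (FImp \<phi> \<psi>)
  then show ?case by (metis UnCI free_vars.simps(5) satisfies.simps(5))
next
  case (FAll i \<phi>)
  have "satisfies G (e(i := a)) \<phi> \<longleftrightarrow> satisfies G (e'(i := a)) \<phi>" for a
    by (rule FAll.IH) (use FAll.prems in auto)
  then show ?case by simp
next
  case (FEx i \<phi>)
  have "satisfies G (e(i := a)) \<phi> \<longleftrightarrow> satisfies G (e'(i := a)) \<phi>" for a
    by (rule FEx.IH) (use FEx.prems in auto)
  then show ?case by simp
qed

lemma models_iff_satisfies_one:
  assumes "sentence \<sigma>" "group G"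
  shows "models G \<sigma> \<longleftrightarrow> satisfies G (one_val G) \<sigma>"
proof -
  interpret group G by fact
  have "satisfies G e \<sigma> \<longleftrightarrow> satisfies G (one_val G) \<sigma>" for e
    by (rule satisfies_cong) (use assms in \<open>auto simp: sentence_def\<close>)
  moreover have "range (one_val G) \<subseteq> carrier G" by auto
  ultimately show ?thesis unfolding models_def by blast
qed

lemma term_val_closed:
  assumes "group G" "range e \<subseteq> carrier G"
  shows "term_val G e t \<in> carrier G"
proof -
  interpret group G by fact
  show ?thesis using assms by (induction t) auto
qed

lemma range_fun_upd: "range e \<subseteq> A \<Longrightarrow> a \<in> A \<Longrightarrow> range (e(i := a)) \<subseteq> A"
  by auto

lemma term_val_hom:
  assumes "group_hom G H h" "range e \<subseteq> carrier G"
  shows "term_val H (h \<circ> e) t = h (term_val G e t)"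
proof -
  interpret group_hom G H h by fact
  show ?thesis
    using assms(2) by (induction t) (auto simp: term_val_closed[OF G.is_group])
qed

lemma satisfies_bij_hom:
  assumes "group_hom G H h" "bij_betw h (carrier G) (carrier H)" "range e \<subseteq> carrier G"
  shows "satisfies H (h \<circ> e) \<phi> \<longleftrightarrow> satisfies G e \<phi>"
  using assms(3)
proof (induction \<phi> arbitrary: e)
  case (FEq s t)
  interpret group_hom G H h by fact
  have "inj_on h (carrier G)" using assms(2) by (simp add: bij_betw_def)
  then show ?case using term_val_closed[OF G.is_group FEq]
    by (simp add: term_val_hom[OF assms(1) FEq] inj_on_eq_iff del: o_apply)
next
  case (FAll i \<phi>)
  have "(h \<circ> e)(i := h a) = h \<circ> (e(i := a))" for a by auto
  then have "satisfies H ((h \<circ> e)(i := h a)) \<phi> \<longleftrightarrow> satisfies G (e(i := a)) \<phi>"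
    if "a \<in> carrier G" for a
    using FAll.IH[OF range_fun_upd[OF FAll.prems that]] by metis
  then show ?case
    unfolding satisfies.simps bij_betw_imp_surj_on[OF assms(2), symmetric] by blast
next
  case (FEx i \<phi>)
  have "(h \<circ> e)(i := h a) = h \<circ> (e(i := a))" for a by auto
  then have "satisfies H ((h \<circ> e)(i := h a)) \<phi> \<longleftrightarrow> satisfies G (e(i := a)) \<phi>"
    if "a \<in> carrier G" for a
    using FEx.IH[OF range_fun_upd[OF FEx.prems that]] by metis
  then show ?case
    unfolding satisfies.simps bij_betw_imp_surj_on[OF assms(2), symmetric] by blast
qed auto

text \<open>
  This moves sentences between product groups, whose elements are pairs, and their copies on
  sets of natural numbers.
\<close>

lemma models_iso:
  assumes "sentence \<sigma>" "group G" "group H" "G \<cong> H"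
  shows "models G \<sigma> \<longleftrightarrow> models H \<sigma>"
proof -
  obtain h where h: "h \<in> iso G H" using assms(4) by (auto simp: is_iso_def)
  have hom: "group_hom G H h"
    using assms h by (simp add: group_hom_def group_hom_axioms_def iso_def)
  interpret group_hom G H h by (rule hom)
  have "h \<circ> one_val G = one_val H" by auto
  moreover have "range (one_val G) \<subseteq> carrier G" by auto
  ultimately show ?thesis
    using satisfies_bij_hom[OF hom, of "one_val G" \<sigma>] h assms
    by (simp add: models_iff_satisfies_one iso_def del: o_apply)
qed

section \<open>Truth in a direct product\<close>

primrec truth_pattern :: "grp_form set \<Rightarrow> grp_form list \<Rightarrow> grp_form" where
  "truth_pattern A [] = FEq TOne TOne"
| "truth_pattern A (\<psi> # \<psi>s) = FAnd (if \<psi> \<in> A then \<psi> else FNot \<psi>) (truth_pattern A \<psi>s)"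

lemma satisfies_truth_pattern:
  "satisfies G e (truth_pattern A \<psi>s) \<longleftrightarrow> (\<forall>\<psi>\<in>set \<psi>s. satisfies G e \<psi> \<longleftrightarrow> \<psi> \<in> A)"
  by (induction \<psi>s) auto

text \<open>
  The truth values of these formulas say exactly which truth assignments to \<open>\<psi>s\<close> can be reached
  by a new choice of the \<open>i\<close>-th variable.
\<close>

definition ex_patterns :: "nat \<Rightarrow> grp_form list \<Rightarrow> grp_form list" where
  "ex_patterns i \<psi>s = map (\<lambda>A. FEx i (truth_pattern (set A) \<psi>s)) (subseqs \<psi>s)"

text \<open>
  The formulas whose truth values in the factors decide \<open>\<phi>\<close> in the product. Both quantifiers
  need the same ones: what matters is which assignments of truth values to the components of the
  body are realised by elements of each factor.
\<close>

primrec components :: "grp_form \<Rightarrow> grp_form list" where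
  "components (FEq s t) = [FEq s t]"
| "components (FNot \<phi>) = components \<phi>"
| "components (FAnd \<phi> \<psi>) = components \<phi> @ components \<psi>"
| "components (FOr \<phi> \<psi>) = components \<phi> @ components \<psi>"
| "components (FImp \<phi> \<psi>) = components \<phi> @ components \<psi>"
| "components (FAll i \<phi>) = ex_patterns i (components \<phi>)"
| "components (FEx i \<phi>) = ex_patterns i (components \<phi>)"

definition agree_on ::
  "grp_form list \<Rightarrow> 'a monoid \<Rightarrow> (nat \<Rightarrow> 'a) \<Rightarrow> 'b monoid \<Rightarrow> (nat \<Rightarrow> 'b) \<Rightarrow> bool" where
  "agree_on \<psi>s G e G' e' \<longleftrightarrow>
     group G \<and> range e \<subseteq> carrier G \<and> group G' \<and> range e' \<subseteq> carrier G' \<and>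
     (\<forall>\<psi>\<in>set \<psi>s. satisfies G e \<psi> \<longleftrightarrow> satisfies G' e' \<psi>)"

lemma agree_on_sym: "agree_on \<psi>s G e G' e' \<Longrightarrow> agree_on \<psi>s G' e' G e"
  by (auto simp: agree_on_def)

lemma agree_on_append:
  "agree_on (\<psi>s @ \<chi>s) G e G' e' \<longleftrightarrow> agree_on \<psi>s G e G' e' \<and> agree_on \<chi>s G e G' e'"
  by (auto simp: agree_on_def)

text \<open>
  One step of a back-and-forth game: an element \<open>a\<close> of \<open>G\<close> realises some truth assignment to \<open>\<psi>s\<close>,
  the existential formula for that assignment holds in \<open>G\<close> and so in \<open>G'\<close>, and a witness there is
  the answer to \<open>a\<close>.
\<close>

lemma agree_on_extend:
  assumes "agree_on (ex_patterns i \<psi>s) G e G' e'" "a \<in> carrier G"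
  obtains a' where "a' \<in> carrier G'" "agree_on \<psi>s G (e(i := a)) G' (e'(i := a'))"
proof -
  define A where "A = {\<psi> \<in> set \<psi>s. satisfies G (e(i := a)) \<psi>}"
  have "A \<in> set ` set (subseqs \<psi>s)" by (auto simp: subseqs_powset A_def)
  then have mem: "FEx i (truth_pattern A \<psi>s) \<in> set (ex_patterns i \<psi>s)"
    by (auto simp: ex_patterns_def)
  have "satisfies G (e(i := a)) (truth_pattern A \<psi>s)"
    by (auto simp: satisfies_truth_pattern A_def)
  then have "satisfies G e (FEx i (truth_pattern A \<psi>s))" using assms(2) by auto
  then have "satisfies G' e' (FEx i (truth_pattern A \<psi>s))"
    using assms(1) mem unfolding agree_on_def by blast
  then obtain a' where a': "a' \<in> carrier G'" "satisfies G' (e'(i := a')) (truth_pattern A \<psi>s)"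
    by auto
  have "agree_on \<psi>s G (e(i := a)) G' (e'(i := a'))"
    using assms a' unfolding agree_on_def
    by (auto simp: satisfies_truth_pattern A_def image_subset_iff)
  with a'(1) show thesis by (rule that)
qed

abbreviation pair_val :: "(nat \<Rightarrow> 'a) \<Rightarrow> (nat \<Rightarrow> 'b) \<Rightarrow> nat \<Rightarrow> 'a \<times> 'b" where
  "pair_val e f \<equiv> \<lambda>i. (e i, f i)"

lemma term_val_DirProd:
  assumes "group G" "group H" "range e \<subseteq> carrier G" "range f \<subseteq> carrier H"
  shows "term_val (G \<times>\<times> H) (pair_val e f) t = (term_val G e t, term_val H f t)"
  using assms by (induction t) (auto simp: term_val_closed)

lemma pair_val_upd: "(pair_val e f)(i := (a, b)) = pair_val (e(i := a)) (f(i := b))"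
  by auto

text \<open>
  The quantifier step for products: a pair is answered by answering its two coordinates
  independently. Applied in both directions it covers the universal and the existential quantifier.
\<close>

lemma satisfies_DirProd_match_element:
  assumes "agree_on (ex_patterns i (components \<phi>)) G e G' e'"
    and "agree_on (ex_patterns i (components \<phi>)) H f H' f'"
    and IH: "\<And>e e' f f'. agree_on (components \<phi>) G e G' e' \<Longrightarrow>
      agree_on (components \<phi>) H f H' f' \<Longrightarrow>
      satisfies (G \<times>\<times> H) (pair_val e f) \<phi> \<longleftrightarrow> satisfies (G' \<times>\<times> H') (pair_val e' f') \<phi>"
    and "a \<in> carrier (G \<times>\<times> H)"
  shows "\<exists>b\<in>carrier (G' \<times>\<times> H'). satisfies (G \<times>\<times> H) ((pair_val e f)(i := a)) \<phi> \<longleftrightarrow>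
    satisfies (G' \<times>\<times> H') ((pair_val e' f')(i := b)) \<phi>"
proof -
  obtain x y where a: "a = (x, y)" "x \<in> carrier G" "y \<in> carrier H" using assms(4) by auto
  obtain x' where x': "x' \<in> carrier G'"
    "agree_on (components \<phi>) G (e(i := x)) G' (e'(i := x'))"
    using agree_on_extend[OF assms(1) a(2)] .
  obtain y' where y': "y' \<in> carrier H'"
    "agree_on (components \<phi>) H (f(i := y)) H' (f'(i := y'))"
    using agree_on_extend[OF assms(2) a(3)] .
  show ?thesis
    using IH[OF x'(2) y'(2)] x'(1) y'(1) unfolding a(1)
    by (intro bexI[of _ "(x', y')"]) (auto simp: pair_val_upd)
qed

text \<open>
  An equation holds in a product iff it holds in both factors, and the components are closed under
  what the induction asks for: the connectives need the components of the parts, the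
  quantifiers the back-and-forth step.
\<close>

theorem satisfies_DirProd_agree:
  fixes G G' :: "'a monoid" and H H' :: "'b monoid"
  assumes "agree_on (components \<phi>) G e G' e'" "agree_on (components \<phi>) H f H' f'"
  shows "satisfies (G \<times>\<times> H) (pair_val e f) \<phi> \<longleftrightarrow> satisfies (G' \<times>\<times> H') (pair_val e' f') \<phi>"
  using assms
proof (induction \<phi> arbitrary: e e' f f')
  case (FEq s t)
  then show ?case by (auto simp: agree_on_def term_val_DirProd)
next
  case (FAll i \<phi>)
  note sym = agree_on_sym[OF FAll.prems(1)[simplified]] agree_on_sym[OF FAll.prems(2)[simplified]]
  have IH': "satisfies (G' \<times>\<times> H') (pair_val e f) \<phi> \<longleftrightarrow> satisfies (G \<times>\<times> H) (pair_val e' f') \<phi>"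
    if "agree_on (components \<phi>) G' e G e'" "agree_on (components \<phi>) H' f H f'" for e e' f f'
    using FAll.IH[OF agree_on_sym[OF that(1)] agree_on_sym[OF that(2)]] by simp
  show ?case
    using satisfies_DirProd_match_element[OF FAll.prems[simplified] FAll.IH]
      satisfies_DirProd_match_element[OF sym IH']
    unfolding satisfies.simps by blast
next
  case (FEx i \<phi>)
  note sym = agree_on_sym[OF FEx.prems(1)[simplified]] agree_on_sym[OF FEx.prems(2)[simplified]]
  have IH': "satisfies (G' \<times>\<times> H') (pair_val e f) \<phi> \<longleftrightarrow> satisfies (G \<times>\<times> H) (pair_val e' f') \<phi>"
    if "agree_on (components \<phi>) G' e G e'" "agree_on (components \<phi>) H' f H f'" for e e' f f'
    using FEx.IH[OF agree_on_sym[OF that(1)] agree_on_sym[OF that(2)]] by simp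
  show ?case
    using satisfies_DirProd_match_element[OF FEx.prems[simplified] FEx.IH]
      satisfies_DirProd_match_element[OF sym IH']
    unfolding satisfies.simps by blast
qed (unfold components.simps agree_on_append satisfies.simps, blast+)

section \<open>Simple groups of unbounded order\<close>

lemma obtain_nat_copy:
  assumes "group G" "finite (carrier G)"
  obtains H :: "nat monoid" where "group H" "G \<cong> H"
proof -
  obtain f :: "'a \<Rightarrow> nat" where f: "inj_on f (carrier G)"
    using finite_imp_inj_to_nat_seg[OF assms(2)] by blast
  show thesis
    using that[of "image_group f G"] group.inj_imp_image_group_is_group[OF assms(1) f]
      is_isoI[OF inj_imp_image_group_iso[OF f]] by blast
qed

lemma nonabelian_simple_iso:
  assumes "nonabelian_simple S" "group T" "S \<cong> T"
  shows "nonabelian_simple T"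
proof -
  interpret S: simple_group S using assms by (simp add: nonabelian_simple_def)
  have "simple_group T" using S.iso_simple assms by (auto simp: is_iso_def)
  moreover have "T \<cong> S" using S.iso_sym assms by blast
  then have "comm_group S" if "comm_group T"
    using comm_group.iso_imp_comm_group[OF that] S.is_monoid by blast
  ultimately show ?thesis using assms by (auto simp: nonabelian_simple_def)
qed

lemma (in group_hom) normal_vimage:
  assumes "N \<lhd> H"
  shows "{x \<in> carrier G. h x \<in> N} \<lhd> G"
proof -
  interpret N: normal N H by fact
  show ?thesis
  proof (rule G.normal_invI)
    show "subgroup {x \<in> carrier G. h x \<in> N} G"
      by (rule G.subgroupI) (auto intro: exI[of _ "\<one>\<^bsub>G\<^esub>"])
  qed (auto intro: N.inv_op_closed2)
qed

text \<open>
  Take \<open>M\<close> maximal among the proper normal subgroups. The preimage in \<open>G\<close> of a normal subgroup of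
  the quotient lies between \<open>M\<close> and \<open>G\<close>, hence is one of the two.
\<close>

lemma (in group) simple_quotient_exists:
  assumes "finite (carrier G)" "order G > 1"
  obtains M where "M \<lhd> G" "M \<noteq> carrier G" "simple_group (G Mod M)"
proof -
  define P where "P = {N. N \<lhd> G \<and> N \<noteq> carrier G}"
  have "P \<subseteq> Pow (carrier G)"
    using normal_imp_subgroup subgroup.subset by (fastforce simp: P_def)
  then have "finite P" using assms(1) finite_subset by blast
  moreover have "carrier G \<noteq> {\<one>}" using assms(2) unfolding order_def by force
  then have "{\<one>} \<in> P" using one_is_normal by (auto simp: P_def)
  ultimately obtain M where M: "M \<in> P" and max: "\<And>N. N \<in> P \<Longrightarrow> M \<subseteq> N \<Longrightarrow> N = M"
    using finite_has_maximal[of P] by blast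
  interpret M: normal M G using M by (simp add: P_def)
  interpret Q: group "G Mod M" by (rule M.factorgroup_is_group)
  interpret \<pi>: group_hom G "G Mod M" "\<lambda>x. M #> x"
    by unfold_locales (rule M.r_coset_hom_Mod)
  have Qcar: "carrier (G Mod M) = (\<lambda>x. M #> x) ` carrier G" by (rule carrier_FactGroup)
  have fin: "finite (carrier (G Mod M))" unfolding Qcar using assms(1) by simp
  have "simple_group (G Mod M)"
  proof
    have "carrier (G Mod M) \<noteq> {M}"
    proof
      assume eq: "carrier (G Mod M) = {M}"
      have "x \<in> M" if "x \<in> carrier G" for x
        using eq that rcos_self[OF that M.subgroup_axioms] Qcar by blast
      then show False using M M.subset by (auto simp: P_def)
    qed
    moreover have "M \<in> carrier (G Mod M)" using Q.one_closed by simp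
    ultimately have "{M} \<subset> carrier (G Mod M)" by blast
    from psubset_card_mono[OF fin this] show "1 < order (G Mod M)"
      by (simp add: order_def)
  next
    fix H assume H: "H \<lhd> G Mod M"
    interpret H: normal H "G Mod M" by fact
    define K where "K = {x \<in> carrier G. M #> x \<in> H}"
    have HK: "H = (\<lambda>x. M #> x) ` K" using H.subset Qcar by (auto simp: K_def)
    have "K \<lhd> G" unfolding K_def by (rule \<pi>.normal_vimage[OF H])
    moreover have "M \<subseteq> K"
      using M.subset H.one_closed by (auto simp: K_def M.rcos_const)
    ultimately have "K = carrier G \<or> K = M" using max by (auto simp: P_def)
    then show "H = carrier (G Mod M) \<or> H = {\<one>\<^bsub>G Mod M\<^esub>}"
    proof
      assume "K = M"
      then have "H \<subseteq> {M}" unfolding HK by (auto simp: M.rcos_const)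
      then show ?thesis using H.one_closed by auto
    qed (simp add: HK Qcar)
  qed
  then show thesis using that M by (auto simp: P_def)
qed

lemma (in group) derived_subset_of_comm_quotient:
  assumes "N \<lhd> G" "comm_group (G Mod N)"
  shows "derived G (carrier G) \<subseteq> N"
proof -
  interpret N: normal N G by fact
  interpret Q: comm_group "G Mod N" by fact
  interpret \<pi>: group_hom G "G Mod N" "\<lambda>x. N #> x"
    by unfold_locales (rule N.r_coset_hom_Mod)
  have "x \<otimes> y \<otimes> inv x \<otimes> inv y \<in> N" if xy: "x \<in> carrier G" "y \<in> carrier G" for x y
  proof -
    let ?c = "x \<otimes> y \<otimes> inv x \<otimes> inv y"
    have "N #> ?c = (N #> x) \<otimes>\<^bsub>G Mod N\<^esub> (N #> y) \<otimes>\<^bsub>G Mod N\<^esub> inv\<^bsub>G Mod N\<^esub> (N #> x)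
        \<otimes>\<^bsub>G Mod N\<^esub> inv\<^bsub>G Mod N\<^esub> (N #> y)"
      using xy by (simp only: \<pi>.hom_mult \<pi>.hom_inv m_closed inv_closed)
    also have "\<dots> = \<one>\<^bsub>G Mod N\<^esub>"
      using \<pi>.hom_closed[OF xy(1)] \<pi>.hom_closed[OF xy(2)]
      by (metis Q.inv_closed Q.m_assoc Q.m_comm Q.r_inv Q.r_one Q.m_closed)
    finally have "N #> ?c = N" by simp
    moreover have "?c \<in> carrier G" using xy by simp
    ultimately show ?thesis using rcos_self N.subgroup_axioms by blast
  qed
  then show ?thesis
    unfolding derived_def by (intro generate_subgroup_incl N.subgroup_axioms) auto
qed

text \<open>
  Symmetric groups are highly transitive. By recursion on the lists: when \<open>p\<close> is right on the tails,
  a transposition that corrects the image of the head does not disturb them.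
\<close>

lemma permutes_list_to_list:
  assumes "distinct xs" "distinct ys" "length xs = length ys" "set xs \<subseteq> A" "set ys \<subseteq> A"
  obtains p where "p permutes A" "map p xs = ys"
proof -
  from assms(3,1,2,4,5) have "\<exists>p. p permutes A \<and> map p xs = ys"
  proof (induction xs ys rule: list_induct2)
    case Nil
    then show ?case by (auto intro: exI[of _ id])
  next
    case (Cons x xs y ys)
    then obtain p where p: "p permutes A" "map p xs = ys" by auto
    let ?q = "transpose (p x) y \<circ> p"
    have "p x \<in> A" using p(1) Cons.prems by (simp add: permutes_in_image)
    then have "?q permutes A"
      using Cons.prems by (intro permutes_compose[OF p(1)] permutes_swap_id) auto
    moreover have "p x \<notin> set ys"
      using Cons.prems(1) unfolding p(2)[symmetric]
      by (simp add: inj_image_mem_iff[OF permutes_inj[OF p(1)]])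
    then have "map (transpose (p x) y) ys = ys"
      using Cons.prems(2) by (intro map_idI) (auto simp: transpose_def)
    then have "map ?q (x # xs) = y # ys" using p(2) by (simp flip: map_map)
    ultimately show ?case by (intro exI[of _ ?q] conjI)
  qed
  then show thesis using that by blast
qed

text \<open>
  All 3-cycles are conjugate in \<open>A\<^sub>n\<close> for \<open>n \<ge> 5\<close>: a permutation that conjugates one into another
  can be made even by composing it with a transposition of two points outside the target cycle.
  As the 3-cycles generate \<open>A\<^sub>n\<close>, one of them in \<open>N\<close> is enough.
\<close>

lemma alt_group_three_cycle_normal_closure:
  assumes "5 \<le> n" "N \<lhd> alt_group n" "t \<in> three_cycles n" "t \<in> N"
  shows "N = carrier (alt_group n)"
proof -
  interpret N: normal N "alt_group n" by fact
  have "three_cycles n \<subseteq> N"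
  proof
    fix s assume "s \<in> three_cycles n"
    then obtain ds where ds: "s = cycle_of_list ds" "cycle ds" "length ds = 3" "set ds \<subseteq> {1..n}"
      by blast
    obtain cs where cs: "t = cycle_of_list cs" "cycle cs" "length cs = 3" "set cs \<subseteq> {1..n}"
      using assms(3) by blast
    have "card (set ds) = 3" using ds by (simp add: distinct_card)
    then have "card ({1..n} - set ds) \<ge> 2"
      using assms(1) ds(4) by (simp add: card_Diff_subset)
    then obtain x y where xy: "x \<in> {1..n} - set ds" "y \<in> {1..n} - set ds" "x \<noteq> y"
      by (metis card_2_iff insert_subset obtain_subset_with_card_n)
    obtain p where p: "p permutes {1..n}" "map p cs = ds"
      using permutes_list_to_list[of cs ds "{1..n}"] cs ds by auto
    \<comment> \<open>The parity correction; \<open>x\<close> and \<open>y\<close> exist because \<open>n \<ge> 5\<close>.\<close>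
    define q where "q = (if evenperm p then p else transpose x y \<circ> p)"
    have tr: "transpose x y permutes {1..n}" using xy by (intro permutes_swap_id) auto
    have pp: "permutation p" using p(1) by (auto simp: permutation_permutes)
    have "map (transpose x y) ds = ds"
      using xy by (intro map_idI) (auto simp: transpose_def)
    then have "map q cs = ds" using p(2) by (auto simp: q_def simp flip: map_map)
    moreover have "evenperm q"
      using xy pp by (auto simp: q_def evenperm_comp permutation_swap_id evenperm_swap)
    moreover have "q permutes {1..n}" using p(1) tr by (auto simp: q_def permutes_compose)
    ultimately have q: "q \<in> carrier (alt_group n)" "map q cs = ds"
      by (auto simp: alt_group_carrier)
    have "q \<circ> t \<circ> inv' q = s"
      unfolding cs(1) ds(1) using conjugation_of_cycle[OF cs(2)] q
      by (metis alt_group_carrier permutes_bij)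
    then show "s \<in> N"
      using N.inv_op_closed2[OF q(1) assms(4)] alt_group_inv_equality[OF q(1)]
      by (simp add: alt_group_mult)
  qed
  then have "generate (alt_group n) (three_cycles n) \<subseteq> N"
    by (rule N.generate_subgroup_incl[OF _ N.subgroup_axioms])
  then show ?thesis
    using N.subset unfolding alt_group_carrier_as_three_cycles[of n, symmetric] by blast
qed

text \<open>
  The pigeonhole argument on the cosets of the cycles \<open>(1 2 i)\<close> with \<open>3 \<le> i \<le> n\<close>. Products of
  permutations are compositions, the right factor acting first, so that
  \<open>(1 2 i) = (1 j i) (1 2 j)\<close>.
\<close>

lemma alt_group_quotient_large:
  assumes "5 \<le> n" "N \<lhd> alt_group n" "N \<noteq> carrier (alt_group n)"
  shows "n \<le> order (alt_group n Mod N) + 2"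
proof (rule ccontr)
  assume less: "\<not> ?thesis"
  interpret N: normal N "alt_group n" by fact
  define c where "c i = cycle_of_list [1, 2, i]" for i :: nat
  have three: "cycle_of_list [i, j, k] \<in> three_cycles n"
    if "distinct [i, j, k]" "{i, j, k} \<subseteq> {1..n}" for i j k
    using that by (intro CollectI exI[of _ "[i, j, k]"]) auto
  then have c: "c i \<in> carrier (alt_group n)" if "i \<in> {3..n}" for i
    using three_cycles_incl[of n] three[of 1 2 i] that assms(1) unfolding c_def by auto
  have "finite (carrier (alt_group n))"
    by (rule finite_subset[OF _ finite_permutations[of "{1..n}"]]) (auto simp: alt_group_carrier)
  then have fin: "finite (carrier (alt_group n Mod N))" by (simp add: carrier_FactGroup)
  have "\<not> inj_on (\<lambda>i. N #>\<^bsub>alt_group n\<^esub> c i) {3..n}"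
  proof (rule pigeonhole)
    have "(\<lambda>i. N #>\<^bsub>alt_group n\<^esub> c i) ` {3..n} \<subseteq> carrier (alt_group n Mod N)"
      using c by (auto simp: carrier_FactGroup)
    from card_mono[OF fin this]
    show "card {3..n} > card ((\<lambda>i. N #>\<^bsub>alt_group n\<^esub> c i) ` {3..n})"
      using less by (simp add: order_def)
  qed
  then obtain i j where ij: "i \<in> {3..n}" "j \<in> {3..n}" "i \<noteq> j"
    and eq: "N #>\<^bsub>alt_group n\<^esub> c i = N #>\<^bsub>alt_group n\<^esub> c j"
    by (auto simp: inj_on_def)
  define t where "t = cycle_of_list [1, j, i]"
  have t3: "t \<in> three_cycles n" unfolding t_def by (rule three) (use ij in auto)
  then have t: "t \<in> carrier (alt_group n)" using three_cycles_incl by blast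
  have "c i = t \<otimes>\<^bsub>alt_group n\<^esub> c j"
    using ij by (auto simp: alt_group_mult c_def t_def transpose_def fun_eq_iff)
  then have "t = c i \<otimes>\<^bsub>alt_group n\<^esub> inv\<^bsub>alt_group n\<^esub> (c j)"
    using t c[OF ij(2)] by (simp add: N.m_assoc)
  also have "\<dots> \<in> N"
    using N.rcos_self[OF c[OF ij(1)] N.subgroup_axioms]
    unfolding eq by (rule N.rcos_module_imp[OF N.is_group c[OF ij(2)]])
  finally show False
    using alt_group_three_cycle_normal_closure[OF assms(1,2) t3] assms(3) by blast
qed

lemma nonabelian_simple_of_large_order:
  obtains S :: "nat monoid" where "nonabelian_simple S" "order S > n"
proof -
  let ?A = "alt_group (n + 5)"
  interpret A: group ?A by (rule alt_group_is_group)
  have fin: "finite (carrier ?A)"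
    by (rule finite_subset[OF _ finite_permutations[of "{1..n+5}"]]) (auto simp: alt_group_carrier)
  have "cycle_of_list [1, 2, 3] \<in> three_cycles (n + 5)"
    by (intro CollectI exI[of _ "[1, 2, 3]"]) auto
  then have "{cycle_of_list [1, 2, 3], id} \<subseteq> carrier ?A"
    using three_cycles_incl A.one_closed alt_group_one by fastforce
  moreover have "cycle_of_list [1, 2, 3] \<noteq> (id :: nat \<Rightarrow> nat)"
    by (auto simp: fun_eq_iff transpose_def)
  ultimately have "1 < order ?A" unfolding order_def
    using card_mono[OF fin, of "{cycle_of_list [1, 2, 3], id}"] by simp
  then obtain M where M: "M \<lhd> ?A" "M \<noteq> carrier ?A" "simple_group (?A Mod M)"
    using A.simple_quotient_exists[OF fin] by blast
  interpret M: normal M ?A by fact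
  have "\<not> comm_group (?A Mod M)"
    using A.derived_subset_of_comm_quotient[OF M(1)] derived_alt_group_const[of "n + 5"]
      M(2) M.subset by auto
  then have simple: "nonabelian_simple (?A Mod M)" using M(3) by (simp add: nonabelian_simple_def)
  have "finite (carrier (?A Mod M))" using fin by (simp add: carrier_FactGroup)
  then obtain S :: "nat monoid" where S: "group S" "?A Mod M \<cong> S"
    using obtain_nat_copy[OF M.factorgroup_is_group] by blast
  show thesis
  proof (rule that)
    show "nonabelian_simple S" by (rule nonabelian_simple_iso[OF simple S])
    show "order S > n"
      using alt_group_quotient_large[of "n + 5", OF _ M(1,2)] iso_same_card[OF S(2)]
      by (simp add: order_def)
  qed
qed

section \<open>Simple quotients of a power\<close>

text \<open>
  Some factor of the power has non-trivial image in \<open>S\<close>. That image is normal, because the factor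
  is normal and \<open>g\<close> is surjective, so it is all of \<open>S\<close>; and by simplicity of \<open>R\<close> the factor is
  mapped injectively. So \<open>S\<close> is isomorphic to \<open>R\<close>, of which only the order is recorded.
\<close>

lemma simple_quotient_of_power_order:
  assumes "simple_group R" "simple_group S" "group_hom (product_group I (\<lambda>_. R)) S g"
    and surj: "g ` carrier (product_group I (\<lambda>_. R)) = carrier S" and "finite I"
  shows "order S = order R"
proof -
  let ?P = "product_group I (\<lambda>_. R)"
  interpret R: simple_group R by fact
  interpret S: simple_group S by fact
  interpret g: group_hom ?P S g by fact
  define \<iota> where "\<iota> i r = (\<lambda>j\<in>I. if j = i then r else \<one>\<^bsub>R\<^esub>)" for i r
  have \<iota>_hom: "group_hom R ?P (\<iota> i)" for i
    by unfold_locales (auto simp: hom_def \<iota>_def fun_eq_iff)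
  define f where "f i = g \<circ> \<iota> i" for i
  have f_hom: "group_hom R S (f i)" for i
    using group_hom.homh[OF \<iota>_hom[of i]] g.homh hom_compose
    by (metis f_def R.is_group S.is_group group_hom.intro group_hom_axioms.intro)
  \<comment> \<open>The factors generate the power, so one of them has non-trivial image.\<close>
  have "\<exists>i\<in>I. \<exists>r\<in>carrier R. f i r \<noteq> \<one>\<^bsub>S\<^esub>"
  proof (rule ccontr)
    assume "\<not> ?thesis"
    then have triv: "g (\<iota> i r) = \<one>\<^bsub>S\<^esub>" if "i \<in> I" "r \<in> carrier R" for i r
      using that by (auto simp: f_def)
    \<comment> \<open>Build \<open>x\<close> up one coordinate at a time, keeping the value of \<open>g\<close> trivial.\<close>
    have trunc: "g (\<lambda>j\<in>I. if j \<in> J then x j else \<one>\<^bsub>R\<^esub>) = \<one>\<^bsub>S\<^esub>"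
      if x: "x \<in> carrier ?P" and "J \<subseteq> I" for x J
      using finite_subset[OF \<open>J \<subseteq> I\<close> \<open>finite I\<close>] \<open>J \<subseteq> I\<close>
    proof (induction J rule: finite_induct)
      case empty
      show ?case using g.hom_one by (simp add: restrict_def)
    next
      case (insert i J)
      let ?y = "\<lambda>j\<in>I. if j \<in> J then x j else \<one>\<^bsub>R\<^esub>"
      have i: "i \<in> I" "x i \<in> carrier R" using insert.prems x by auto
      have "?y \<in> carrier ?P" using x by auto
      moreover have "\<iota> i (x i) \<in> carrier ?P" using i by (auto simp: \<iota>_def)
      moreover have "(\<lambda>j\<in>I. if j \<in> insert i J then x j else \<one>\<^bsub>R\<^esub>) = ?y \<otimes>\<^bsub>?P\<^esub> \<iota> i (x i)"
        using x insert.hyps(2) i by (auto simp: \<iota>_def fun_eq_iff PiE_iff)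
      ultimately show ?case
        using insert.IH insert.prems triv[OF i] by (metis (lifting) S.l_one S.one_closed g.hom_mult insert_subset)
    qed
    have "g x = \<one>\<^bsub>S\<^esub>" if "x \<in> carrier ?P" for x
    proof -
      have "(\<lambda>j\<in>I. if j \<in> I then x j else \<one>\<^bsub>R\<^esub>) = x"
        using that by (auto simp: fun_eq_iff PiE_iff extensional_def)
      then show ?thesis using trunc[OF that subset_refl] by simp
    qed
    then have "carrier S \<subseteq> {\<one>\<^bsub>S\<^esub>}" unfolding surj[symmetric] by blast
    then show False using S.simple_not_triv S.one_closed by blast
  qed
  then obtain i r where i: "i \<in> I" and r: "r \<in> carrier R" "f i r \<noteq> \<one>\<^bsub>S\<^esub>" by blast
  interpret f: group_hom R S "f i" by (rule f_hom)
  have "f i ` carrier R \<lhd> S"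
  proof (rule S.normal_invI)
    show "subgroup (f i ` carrier R) S" by (rule f.img_is_subgroup)
    fix s y assume s: "s \<in> carrier S" and "y \<in> f i ` carrier R"
    then obtain r where r: "r \<in> carrier R" "y = g (\<iota> i r)" by (auto simp: f_def)
    obtain x where x: "x \<in> carrier ?P" "s = g x" using s surj by blast
    have xi: "x i \<in> carrier R" using x(1) i by auto
    have \<iota>r: "\<iota> i r \<in> carrier ?P" using r by (auto simp: \<iota>_def)
    have "x \<otimes>\<^bsub>?P\<^esub> \<iota> i r \<otimes>\<^bsub>?P\<^esub> inv\<^bsub>?P\<^esub> x = \<iota> i (x i \<otimes>\<^bsub>R\<^esub> r \<otimes>\<^bsub>R\<^esub> inv\<^bsub>R\<^esub> x i)"
      using x(1) r(1) i by (auto simp: \<iota>_def fun_eq_iff PiE_iff R.is_group)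
    then have "s \<otimes>\<^bsub>S\<^esub> y \<otimes>\<^bsub>S\<^esub> inv\<^bsub>S\<^esub> s = f i (x i \<otimes>\<^bsub>R\<^esub> r \<otimes>\<^bsub>R\<^esub> inv\<^bsub>R\<^esub> x i)"
      using x(1) \<iota>r g.hom_mult g.hom_inv unfolding f_def r(2) x(2)
      by (metis comp_apply g.G.inv_closed g.G.m_closed)
    moreover have "x i \<otimes>\<^bsub>R\<^esub> r \<otimes>\<^bsub>R\<^esub> inv\<^bsub>R\<^esub> x i \<in> carrier R" using xi r(1) by simp
    ultimately show "s \<otimes>\<^bsub>S\<^esub> y \<otimes>\<^bsub>S\<^esub> inv\<^bsub>S\<^esub> s \<in> f i ` carrier R" by (metis imageI)
  qed
  then have "f i ` carrier R = carrier S"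
    using S.no_real_normal_subgroup r by blast
  moreover have "kernel R S (f i) = {\<one>\<^bsub>R\<^esub>}"
    using R.no_real_normal_subgroup[OF f.normal_kernel] r by (auto simp: kernel_def)
  then have "inj_on (f i) (carrier R)" by (simp add: f.inj_iff_trivial_ker)
  ultimately show ?thesis unfolding order_def by (metis card_image)
qed

lemma product_not_power_of_simple:
  fixes G :: "nat monoid" and S T :: "'a monoid"
  assumes "simple_group S" "simple_group T" "order S \<noteq> order T" "group G" "G \<cong> S \<times>\<times> T"
  shows "\<not> is_power_of_nonabelian_simple G"
proof
  assume "is_power_of_nonabelian_simple G"
  then obtain R :: "nat monoid" and k :: nat where R: "simple_group R"
    and iso: "G \<cong> product_group {..<k} (\<lambda>_. R)"
    by (auto simp: is_power_of_nonabelian_simple_def nonabelian_simple_def)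
  let ?P = "product_group {..<k} (\<lambda>_. R)"
  interpret R: simple_group R by fact
  interpret S: simple_group S by fact
  interpret T: simple_group T by fact
  interpret P: group ?P by (simp add: R.is_group)
  have "?P \<cong> S \<times>\<times> T" using group.iso_sym[OF assms(4) iso] assms(5) by (rule iso_trans)
  then obtain h where h: "h \<in> hom ?P (S \<times>\<times> T)" "h ` carrier ?P = carrier S \<times> carrier T"
    by (auto simp: is_iso_def iso_def bij_betw_def)
  have "group_hom ?P S (fst \<circ> h)" "group_hom ?P T (snd \<circ> h)"
    using h(1) by unfold_locales (simp_all add: hom_pairwise)
  moreover have "(fst \<circ> h) ` carrier ?P = carrier S" "(snd \<circ> h) ` carrier ?P = carrier T"
    unfolding image_comp[symmetric] h(2) using S.one_closed T.one_closed by auto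
  ultimately have "order S = order R" "order T = order R"
    using simple_quotient_of_power_order[OF R] assms(1,2) by blast+
  then show False using assms(3) by simp
qed

lemma square_imp_power:
  assumes "is_square_of_nonabelian_simple G"
  shows "is_power_of_nonabelian_simple G"
proof -
  obtain S :: "'a monoid" where S: "nonabelian_simple S" "G \<cong> S \<times>\<times> S"
    using assms by (auto simp: is_square_of_nonabelian_simple_def)
  interpret S: simple_group S using S by (simp add: nonabelian_simple_def)
  let ?h = "\<lambda>p. \<lambda>i\<in>{..<2::nat}. if i = 0 then fst p else snd p"
  let ?P = "product_group {..<2::nat} (\<lambda>_. S)"
  have hom: "?h \<in> hom (S \<times>\<times> S) ?P"
    by (auto simp: hom_def fun_eq_iff mult_DirProd' split: if_splits)
  have two: "{..<2::nat} = {0, 1}" by auto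
  have "bij_betw ?h (carrier (S \<times>\<times> S)) (carrier ?P)"
  proof (rule bij_betwI[where g = "\<lambda>x. (x 0, x 1)"])
    show "?h \<in> carrier (S \<times>\<times> S) \<rightarrow> carrier ?P"
      using hom by (simp only: hom_def mem_Collect_eq)
  qed (auto simp: two fun_eq_iff PiE_iff extensional_def)
  with hom have "?h \<in> iso (S \<times>\<times> S) ?P"
    by (simp only: iso_def mem_Collect_eq)
  then have "G \<cong> ?P" using S(2) is_isoI iso_trans by blast
  then show ?thesis using S(1) unfolding is_power_of_nonabelian_simple_def
    by (intro exI[of _ S] exI[of _ 2]) auto
qed

section \<open>A square and a non-power with the same truth value\<close>

text \<open>
  Among simple groups \<open>F n\<close> of order above \<open>n\<close>, infinitely many realise the same truth values of
  \<open>\<psi>s\<close>. Given one of them, \<open>F m\<close>, any other with index above the order of \<open>F m\<close> is larger.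
\<close>

lemma simple_groups_agreeing:
  obtains S T :: "nat monoid" where "nonabelian_simple S" "nonabelian_simple T"
    "order S < order T" "agree_on \<psi>s S (one_val S) T (one_val T)"
proof -
  have "\<exists>S :: nat monoid. nonabelian_simple S \<and> order S > n" for n
    using nonabelian_simple_of_large_order by metis
  then obtain F :: "nat \<Rightarrow> nat monoid" where F: "\<And>n. nonabelian_simple (F n)" "\<And>n. order (F n) > n"
    by metis
  define tv where "tv n = {\<psi> \<in> set \<psi>s. satisfies (F n) (one_val (F n)) \<psi>}" for n
  have "finite (range tv)" by (rule finite_subset[of _ "Pow (set \<psi>s)"]) (auto simp: tv_def)
  then obtain m where "infinite {n. tv n = tv m}"
    using pigeonhole_infinite[of UNIV tv] by auto
  then have "\<exists>n>order (F m). n \<in> {n. tv n = tv m}"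
    unfolding infinite_nat_iff_unbounded by blast
  then obtain n where n: "tv n = tv m" "n > order (F m)" by blast
  have grp: "group (F k)" for k
    using F(1)[of k] by (simp add: nonabelian_simple_def simple_group_def)
  show thesis
  proof (rule that)
    show "order (F m) < order (F n)" using n(2) F(2)[of n] by simp
    have "satisfies (F m) (one_val (F m)) \<psi> \<longleftrightarrow> satisfies (F n) (one_val (F n)) \<psi>"
      if "\<psi> \<in> set \<psi>s" for \<psi>
      using n(1) that unfolding tv_def by blast
    then show "agree_on \<psi>s (F m) (one_val (F m)) (F n) (one_val (F n))"
      unfolding agree_on_def using grp by (auto intro: monoid.one_closed group.is_monoid)
  qed (rule F)+
qed

lemma square_and_nonpower_indistinguishable:
  assumes "sentence \<sigma>"
  obtains G H :: "nat monoid" where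
    "group G" "finite (carrier G)" "is_square_of_nonabelian_simple G"
    "group H" "finite (carrier H)" "\<not> is_power_of_nonabelian_simple H"
    "models G \<sigma> \<longleftrightarrow> models H \<sigma>"
proof -
  obtain S T :: "nat monoid" where ST: "nonabelian_simple S" "nonabelian_simple T"
    "order S < order T" and agree: "agree_on (components \<sigma>) S (one_val S) T (one_val T)"
    using simple_groups_agreeing[of "components \<sigma>"] by blast
  interpret S: simple_group S using ST by (simp add: nonabelian_simple_def)
  interpret T: simple_group T using ST by (simp add: nonabelian_simple_def)
  have fin: "finite (carrier S)" "finite (carrier T)"
    using S.order_gt_one T.order_gt_one S.order_gt_0_iff_finite T.order_gt_0_iff_finite by auto
  have grp: "group (S \<times>\<times> S)" "group (S \<times>\<times> T)"
    by (simp_all add: DirProd_group S.is_group T.is_group)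
  obtain G :: "nat monoid" where G: "group G" "S \<times>\<times> S \<cong> G"
    using obtain_nat_copy[OF grp(1)] fin by auto
  obtain H :: "nat monoid" where H: "group H" "S \<times>\<times> T \<cong> H"
    using obtain_nat_copy[OF grp(2)] fin by auto
  have GH: "G \<cong> S \<times>\<times> S" "H \<cong> S \<times>\<times> T" using group.iso_sym grp G(2) H(2) by blast+
  show thesis
  proof (rule that)
    show "finite (carrier G)" "finite (carrier H)"
      using fin iso_finite[OF G(2)] iso_finite[OF H(2)] by auto
    show "is_square_of_nonabelian_simple G"
      using ST(1) GH(1) by (auto simp: is_square_of_nonabelian_simple_def)
    show "\<not> is_power_of_nonabelian_simple H"
      using product_not_power_of_simple[OF S.is_simple_group T.is_simple_group _ H(1) GH(2)] ST(3)
      by simp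
    have "agree_on (components \<sigma>) S (one_val S) S (one_val S)"
      using agree by (auto simp: agree_on_def)
    from satisfies_DirProd_agree[OF this agree]
    have "models (S \<times>\<times> S) \<sigma> \<longleftrightarrow> models (S \<times>\<times> T) \<sigma>"
      by (simp add: models_iff_satisfies_one assms grp)
    then show "models G \<sigma> \<longleftrightarrow> models H \<sigma>"
      using models_iso[OF assms grp(1) G] models_iso[OF assms grp(2) H] by simp
  qed (fact G H)+
qed

theorem theorem3:
  shows "(\<nexists>\<sigma>. sentence \<sigma> \<and> defines_among_finite_groups \<sigma> is_power_of_nonabelian_simple) \<and>
         (\<nexists>\<sigma>. sentence \<sigma> \<and> defines_among_finite_groups \<sigma> is_square_of_nonabelian_simple)"
proof -
  \<comment> \<open>No class between the squares and the powers is definable.\<close>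
  have "\<not> defines_among_finite_groups \<sigma> P"
    if "sentence \<sigma>"
      and P: "\<And>G. is_square_of_nonabelian_simple G \<Longrightarrow> P G"
        "\<And>G. P G \<Longrightarrow> is_power_of_nonabelian_simple G" for \<sigma> P
    by (rule square_and_nonpower_indistinguishable[OF \<open>sentence \<sigma>\<close>])
      (use P in \<open>unfold defines_among_finite_groups_def, blast\<close>)
  then show ?thesis using square_imp_power by blast
qed

end
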